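(* Let $(\mathbb{G},\mathcal{S})$ be a Ramsey base and let $(\mathbb{X},\mathcal{C})$ be a uniform Ramsey symbol (with $\mathbb{X}=\{X_j\}_{j\in J}$, $\mathcal{C}=\{\psi_j\}_{j\in J}$). If $\mathbb{G}$ admits an $\mathbb{X}$-resolution, then $$R_{(\mathbb{G},\mathcal{S})}(\mathbb{X},\mathcal{C}) = R_{\mathrm{res}_{\mathbb{X}}(\mathbb{G},\mathcal{S})}(\mathbb{X},\mathcal{C}).$$
   Context: All graphs are finite and undirected. For a graph $G$ and a set $A$, $\mathrm{Hom}(G,A)$ is the set of all maps $\rho:E(G)\to A$ ($A$-valued edge-colorings). For graphs $G,X$, the isomorphism set $G/X$ is the set of edge maps $\pi:E(Y)\to E(X)$ induced by graph isomorphisms $V(Y)\to V(X)$, where $Y$ ranges over all subgraphs of $G$; for such $\pi$, $\pi^{-1}(X)$ denotes $Y$ (or its edge set), and for $\rho\in\mathrm{Hom}(G,A)$, $\psi\in\mathrm{Hom}(X,A)$, "$\rho|_{\pi^{-1}(X)}=\psi\circ\pi$" means $\rho(e)=\psi(\pi(e))$ for all $e\in E(Y)$. Index sets $I$ are strictly well-ordered with least element $0$; $I_{\geq k}=\{t\in I: k\le t\}$, and for a family $T$ indexed by $I$, $T_{\geq k}$ is the subfamily indexed by $I_{\ge k}$. A family $\mathbb{X}=\{X_j\}_{j\in J}$ is constituent in $\mathbb{G}=\{G_i\}_{i\in I}$ (written $\mathbb{X}\unlhd\mathbb{G}$) if $G_i/X_j\neq\emptyset$ for all $i\in I$, $j\in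 J$. $\mathbb{G}$ is hereditary if for every $0<i\le k$ in $I$, the family $\{G_s: s<i\}$ is constituent in $\mathbb{G}_{\ge k}$. A Ramsey base is a pair $(\mathbb{G},\mathcal{S})$ with $\mathbb{G}=\{G_i\}_{i\in I}$ hereditary and $\mathcal{S}=\{S_i\}_{i\in I}$, $S_i\subseteq\mathrm{Hom}(G_i,A_i)$ for sets $A_i$. A Ramsey symbol is a pair $(\mathbb{X},\mathcal{C})$ with $\mathbb{X}=\{\mathbb{X}_i\}_{i\in I}$, $\mathbb{X}_i=\{X_j\}_{j\in J_i}$ with $J_i$ finite, $\mathcal{C}=\{C_i\}_{i\in I}$, $C_i=\{\psi_j\}_{j\in J_i}$ with $\psi_j\in\mathrm{Hom}(X_j,A_i)$ (the same color sets $A_i$ as the base), such that $\{\coprod_{j\in J_i}X_j\}_{i\in I}$ is hereditary. The symbol is uniform if $A_i\subseteq A_t$ and $(\mathbb{X}_i,C_i)=(\mathbb{X}_t,C_t)$ for all $i\le t$; one then writes $\mathbb{X}=\{X_j\}_{j\in J}$, $\mathcal{C}=\{\psi_j\}_{j\in J}$. The Ramsey number $R_{(\mathbb{G},\mathcal{S})}(\mathbb{X},\mathcal{C})$ is the least $n\in I$ (if one exists) such that for every $t\ge n$ in $I$ and every $\rho\in S_t$ there exist $j\in J_t$ and $\pi\in G_t/X_j$ with $\rho|_{\pi^{-1}(X_j)}=\psi_j\circ\pi$; if no such $n$ exists, the Ramsey number does not exist. $\mathbb{G}$ admits an $\mathbb{X}$-resolution if there is a minimum $k\in I$ such that $\mathbb{V}\unlhd\mathbb{G}_{\ge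 k}$ for some nonempty $\mathbb{V}\subseteq\mathbb{X}$; then $\mathrm{res}_{\mathbb{X}}(\mathbb{G})=\mathbb{G}_{\ge k}$ and $\mathrm{res}_{\mathbb{X}}(\mathbb{G},\mathcal{S})=(\mathbb{G}_{\ge k},\mathcal{S}_{\ge k})$, a Ramsey base indexed by $I_{\ge k}$.
   Formalization: The coloring sets S_i are assumed nonempty for every index i below the resolution index k; without this the equality can fail, e.g. with all S_i empty the left side is 0 while the right side is k. *)

theory Defs
  imports "HOL-Library.FuncSet"
begin

(* Undirected graphs without parallel edges, so that a vertex map determines the edge map it
   induces.  An edge is the set of its end vertices; loops (singleton edges) are permitted, so
   simple graphs are a special case. *)
record 'v ugraph =
  verts :: "'v set"
  edges :: "'v set set"

definition finite_ugraph :: "'v ugraph \<Rightarrow> bool" where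
  "finite_ugraph G \<longleftrightarrow>
     finite (verts G) \<and> (\<forall>e\<in>edges G. \<exists>u\<in>verts G. \<exists>v\<in>verts G. e = {u, v})"

definition subgraph :: "'v ugraph \<Rightarrow> 'v ugraph \<Rightarrow> bool" where
  "subgraph Y G \<longleftrightarrow> finite_ugraph Y \<and> verts Y \<subseteq> verts G \<and> edges Y \<subseteq> edges G"

definition graph_iso :: "('v \<Rightarrow> 'w) \<Rightarrow> 'v ugraph \<Rightarrow> 'w ugraph \<Rightarrow> bool" where
  "graph_iso f Y X \<longleftrightarrow>
     bij_betw f (verts Y) (verts X) \<and>
     (\<forall>u\<in>verts Y. \<forall>v\<in>verts Y. {u, v} \<in> edges Y \<longleftrightarrow> {f u, f v} \<in> edges X)"

definition Hom :: "'v ugraph \<Rightarrow> 'a set \<Rightarrow> ('v set \<Rightarrow> 'a) set" where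
  "Hom G A = edges G \<rightarrow>\<^sub>E A"

(* The edge map E(Y) \<rightarrow> E(X) induced by f, as a partial map whose domain is E(Y). *)
definition induced_edge_map :: "('v \<Rightarrow> 'w) \<Rightarrow> 'v ugraph \<Rightarrow> 'v set \<rightharpoonup> 'w set" where
  "induced_edge_map f Y = (\<lambda>e. if e \<in> edges Y then Some (f ` e) else None)"

definition iso_set :: "'v ugraph \<Rightarrow> 'w ugraph \<Rightarrow> ('v set \<rightharpoonup> 'w set) set" where
  "iso_set G X = {induced_edge_map f Y | f Y. subgraph Y G \<and> graph_iso f Y X}"

(* The restriction of \<rho> to the domain of \<pi> is \<psi> \<circ> \<pi>. *)
definition agrees_on :: "('v set \<Rightarrow> 'a) \<Rightarrow> ('v set \<rightharpoonup> 'w set) \<Rightarrow> ('w set \<Rightarrow> 'a) \<Rightarrow> bool" where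
  "agrees_on \<rho> \<pi> \<psi> \<longleftrightarrow> (\<forall>e\<in>dom \<pi>. \<rho> e = \<psi> (the (\<pi> e)))"

(* An index set is a nonempty subset I of a well-ordered type; its least element plays the role
   of 0.  A family is a function together with its index set, so a subfamily is the same function
   with a smaller index set. *)
definition zero_index :: "'i::wellorder set \<Rightarrow> 'i" where
  "zero_index I = (LEAST i. i \<in> I)"

definition index_ge :: "'i::wellorder set \<Rightarrow> 'i \<Rightarrow> 'i set" where
  "index_ge I k = {t\<in>I. k \<le> t}"

definition constituent ::
  "'j set \<Rightarrow> ('j \<Rightarrow> 'w ugraph) \<Rightarrow> 'i set \<Rightarrow> ('i \<Rightarrow> 'v ugraph) \<Rightarrow> bool" where
  "constituent J X I G \<longleftrightarrow> (\<forall>i\<in>I. \<forall>j\<in>J. iso_set (G i) (X j) \<noteq> {})"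

definition hereditary :: "'i::wellorder set \<Rightarrow> ('i \<Rightarrow> 'v ugraph) \<Rightarrow> bool" where
  "hereditary I G \<longleftrightarrow>
     (\<forall>i\<in>I. \<forall>k\<in>I. zero_index I < i \<and> i \<le> k \<longrightarrow> constituent {s\<in>I. s < i} G (index_ge I k) G)"

definition ramsey_base ::
  "'i::wellorder set \<Rightarrow> ('i \<Rightarrow> 'v ugraph) \<Rightarrow> ('i \<Rightarrow> 'a set) \<Rightarrow>
   ('i \<Rightarrow> ('v set \<Rightarrow> 'a) set) \<Rightarrow> bool" where
  "ramsey_base I G A S \<longleftrightarrow>
     I \<noteq> {} \<and> (\<forall>i\<in>I. finite_ugraph (G i)) \<and> hereditary I G \<and> (\<forall>i\<in>I. S i \<subseteq> Hom (G i) (A i))"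

definition coproduct :: "'j set \<Rightarrow> ('j \<Rightarrow> 'w ugraph) \<Rightarrow> ('j \<times> 'w) ugraph" where
  "coproduct J X =
     \<lparr>verts = (SIGMA j:J. verts (X j)), edges = (\<Union>j\<in>J. (\<lambda>e. Pair j ` e) ` edges (X j))\<rparr>"

(* The i-th members of the symbol are the families X i j and \<psi> i j, with j ranging over J i. *)
definition ramsey_symbol ::
  "'i::wellorder set \<Rightarrow> ('i \<Rightarrow> 'a set) \<Rightarrow> ('i \<Rightarrow> 'j set) \<Rightarrow> ('i \<Rightarrow> 'j \<Rightarrow> 'w ugraph) \<Rightarrow>
   ('i \<Rightarrow> 'j \<Rightarrow> 'w set \<Rightarrow> 'a) \<Rightarrow> bool" where
  "ramsey_symbol I A J X \<psi> \<longleftrightarrow>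
     I \<noteq> {} \<and>
     (\<forall>i\<in>I. finite (J i) \<and> (\<forall>j\<in>J i. finite_ugraph (X i j) \<and> \<psi> i j \<in> Hom (X i j) (A i))) \<and>
     hereditary I (\<lambda>i. coproduct (J i) (X i))"

definition uniform_symbol ::
  "'i::wellorder set \<Rightarrow> ('i \<Rightarrow> 'a set) \<Rightarrow> ('i \<Rightarrow> 'j set) \<Rightarrow> ('i \<Rightarrow> 'j \<Rightarrow> 'w ugraph) \<Rightarrow>
   ('i \<Rightarrow> 'j \<Rightarrow> 'w set \<Rightarrow> 'a) \<Rightarrow> bool" where
  "uniform_symbol I A J X \<psi> \<longleftrightarrow>
     ramsey_symbol I A J X \<psi> \<and>
     (\<forall>i\<in>I. \<forall>t\<in>I. i \<le> t \<longrightarrow>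
        A i \<subseteq> A t \<and> J i = J t \<and> (\<forall>j\<in>J i. X i j = X t j \<and> \<psi> i j = \<psi> t j))"

definition ramsey_bound ::
  "'i::wellorder set \<Rightarrow> ('i \<Rightarrow> 'v ugraph) \<Rightarrow> ('i \<Rightarrow> ('v set \<Rightarrow> 'a) set) \<Rightarrow>
   ('i \<Rightarrow> 'j set) \<Rightarrow> ('i \<Rightarrow> 'j \<Rightarrow> 'w ugraph) \<Rightarrow> ('i \<Rightarrow> 'j \<Rightarrow> 'w set \<Rightarrow> 'a) \<Rightarrow> 'i \<Rightarrow> bool" where
  "ramsey_bound I G S J X \<psi> n \<longleftrightarrow>
     n \<in> I \<and>
     (\<forall>t\<in>I. n \<le> t \<longrightarrow>
        (\<forall>\<rho>\<in>S t. \<exists>j\<in>J t. \<exists>\<pi>\<in>iso_set (G t) (X t j). agrees_on \<rho> \<pi> (\<psi> t j)))"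

(* None means that the Ramsey number does not exist. *)
definition ramsey_number ::
  "'i::wellorder set \<Rightarrow> ('i \<Rightarrow> 'v ugraph) \<Rightarrow> ('i \<Rightarrow> ('v set \<Rightarrow> 'a) set) \<Rightarrow>
   ('i \<Rightarrow> 'j set) \<Rightarrow> ('i \<Rightarrow> 'j \<Rightarrow> 'w ugraph) \<Rightarrow> ('i \<Rightarrow> 'j \<Rightarrow> 'w set \<Rightarrow> 'a) \<Rightarrow> 'i option" where
  "ramsey_number I G S J X \<psi> =
     (if \<exists>n. ramsey_bound I G S J X \<psi> n then Some (LEAST n. ramsey_bound I G S J X \<psi> n) else None)"

definition resolves_at ::
  "'i::wellorder set \<Rightarrow> ('i \<Rightarrow> 'v ugraph) \<Rightarrow> 'j set \<Rightarrow> ('j \<Rightarrow> 'w ugraph) \<Rightarrow> 'i \<Rightarrow> bool" where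
  "resolves_at I G J X k \<longleftrightarrow> k \<in> I \<and> (\<exists>V. V \<subseteq> J \<and> V \<noteq> {} \<and> constituent V X (index_ge I k) G)"

definition admits_resolution ::
  "'i::wellorder set \<Rightarrow> ('i \<Rightarrow> 'v ugraph) \<Rightarrow> 'j set \<Rightarrow> ('j \<Rightarrow> 'w ugraph) \<Rightarrow> bool" where
  "admits_resolution I G J X \<longleftrightarrow>
     (\<exists>k. resolves_at I G J X k \<and> (\<forall>k'. resolves_at I G J X k' \<longrightarrow> k \<le> k'))"

definition resolution_index ::
  "'i::wellorder set \<Rightarrow> ('i \<Rightarrow> 'v ugraph) \<Rightarrow> 'j set \<Rightarrow> ('j \<Rightarrow> 'w ugraph) \<Rightarrow> 'i" where
  "resolution_index I G J X = (LEAST k. resolves_at I G J X k)"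

(* The index set of the resolution: the resolved base consists of G and S restricted to it. *)
definition resolution_indices ::
  "'i::wellorder set \<Rightarrow> ('i \<Rightarrow> 'v ugraph) \<Rightarrow> 'j set \<Rightarrow> ('j \<Rightarrow> 'w ugraph) \<Rightarrow> 'i set" where
  "resolution_indices I G J X = index_ge I (resolution_index I G J X)"

end

(* Below the resolution index k no index n can be a Ramsey bound: a coloring in the nonempty set
   S n would give a copy of some X j in G n, and since G is hereditary G n, hence X j, occurs in
   every later member, so that {X j} would resolve G already at n < k.  From k on the two bound
   conditions coincide. *)
theory Submission
  imports Defs
begin

lemma iso_set_nonempty_iff: "iso_set G X \<noteq> {} \<longleftrightarrow> (\<exists>f Y. subgraph Y G \<and> graph_iso f Y X)"
  by (auto simp: iso_set_def)

text \<open>A copy \<open>Z\<close> of \<open>H\<close> in \<open>G\<close> is mapped onto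
  \<open>H\<close> by \<open>g\<close>, so the copy \<open>Y\<close> of \<open>X\<close> inside
  \<open>H\<close> can be pulled back along \<open>g\<close> to a copy of \<open>X\<close> in
  \<open>G\<close>, with isomorphism \<open>f \<circ> g\<close>.\<close>

lemma iso_set_nonempty_trans:
  assumes "iso_set G H \<noteq> {}" and "iso_set H X \<noteq> {}"
  shows "iso_set G X \<noteq> {}"
proof -
  obtain g Z where Z: "subgraph Z G" and g: "graph_iso g Z H"
    using assms(1) by (auto simp: iso_set_nonempty_iff)
  obtain f Y where Y: "subgraph Y H" and f: "graph_iso f Y X"
    using assms(2) by (auto simp: iso_set_nonempty_iff)
  define W where "W = {v \<in> verts Z. g v \<in> verts Y}"
  \<comment> \<open>The edges are pulled back from \<open>Y\<close> and not induced from
    \<open>Z\<close>: \<open>Y\<close> need not be an induced subgraph of \<open>H\<close>, so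
    \<open>Z\<close> may have further edges within \<open>W\<close>.\<close>
  define P where "P = \<lparr>verts = W, edges = {{u, v} | u v. u \<in> W \<and> v \<in> W \<and> {g u, g v} \<in> edges Y}\<rparr>"
  have edges_P: "{u, v} \<in> edges P \<longleftrightarrow> {g u, g v} \<in> edges Y" if "u \<in> W" "v \<in> W" for u v
    using that by (auto simp: P_def doubleton_eq_iff insert_commute)
  \<comment> \<open>Edges of \<open>Y\<close> are edges of \<open>H\<close>, and the isomorphism
    \<open>g\<close> reflects these to edges of \<open>Z\<close>.\<close>
  have "edges P \<subseteq> edges Z"
  proof
    fix e assume "e \<in> edges P"
    then obtain u v where e: "e = {u, v}" "u \<in> W" "v \<in> W" "{g u, g v} \<in> edges Y"
      by (auto simp: P_def)
    then have "{g u, g v} \<in> edges H"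
      using Y by (auto simp: subgraph_def)
    then show "e \<in> edges Z"
      using g e(1-3) by (simp add: graph_iso_def W_def)
  qed
  moreover have "finite_ugraph P"
    using Z unfolding finite_ugraph_def subgraph_def P_def W_def by auto
  ultimately have "subgraph P G"
    using Z by (auto simp: subgraph_def P_def W_def)
  moreover have "graph_iso (f \<circ> g) P X"
  proof -
    have "g ` W = verts Y"
    proof -
      have "g ` verts Z = verts H"
        using g by (simp add: graph_iso_def bij_betw_def)
      moreover have "verts Y \<subseteq> verts H"
        using Y by (simp add: subgraph_def)
      ultimately show ?thesis
        by (auto simp: W_def)
    qed
    moreover have "inj_on g W"
      by (rule inj_on_subset[of g "verts Z"]) (use g in \<open>auto simp: W_def graph_iso_def bij_betw_def\<close>)
    ultimately have "bij_betw g W (verts Y)"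
      by (simp add: bij_betw_def)
    then have "bij_betw (f \<circ> g) W (verts X)"
      by (rule bij_betw_trans) (use f in \<open>simp add: graph_iso_def\<close>)
    moreover have "{u, v} \<in> edges P \<longleftrightarrow> {f (g u), f (g v)} \<in> edges X" if "u \<in> W" "v \<in> W" for u v
      using f that by (simp add: edges_P graph_iso_def) (simp add: W_def)
    ultimately show ?thesis
      by (simp add: graph_iso_def P_def)
  qed
  ultimately show ?thesis
    by (auto simp: iso_set_nonempty_iff)
qed

text \<open>Heredity is used with \<open>i = k = t\<close>; the required
  \<open>zero_index I < t\<close> holds because \<open>s\<close> lies in \<open>I\<close> strictly
  below \<open>t\<close>.\<close>

lemma hereditary_iso_set_nonempty:
  assumes "hereditary I G" and "s \<in> I" and "t \<in> I" and "s < t"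
  shows "iso_set (G t) (G s) \<noteq> {}"
proof -
  have "zero_index I < t"
    using Least_le[of "\<lambda>i. i \<in> I" s] assms(2,4) by (simp add: zero_index_def)
  then show ?thesis
    using assms by (auto simp: hereditary_def constituent_def index_ge_def)
qed

lemma ramsey_bound_resolves_at:
  assumes "hereditary I G" and "ramsey_bound I G S J X \<psi> n" and "S n \<noteq> {}"
  shows "resolves_at I G (J n) (X n) n"
proof -
  have n: "n \<in> I"
    using assms(2) by (simp add: ramsey_bound_def)
  obtain \<rho> where "\<rho> \<in> S n"
    using assms(3) by blast
  then obtain j where j: "j \<in> J n" "iso_set (G n) (X n j) \<noteq> {}"
    using assms(2) n unfolding ramsey_bound_def by blast
  have "iso_set (G t) (X n j) \<noteq> {}" if "t \<in> I" "n \<le> t" for t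
  \<comment> \<open>Heredity embeds only strictly earlier members, so \<open>t = n\<close> is
    treated apart; there the copy found by the coloring itself serves.\<close>
  proof (cases "n = t")
    case False
    then show ?thesis
      using hereditary_iso_set_nonempty[OF assms(1) n that(1)] that(2)
      by (simp add: iso_set_nonempty_trans[OF _ j(2)])
  qed (use j in simp)
  then have "constituent {j} (X n) (index_ge I n) G"
    by (simp add: constituent_def index_ge_def)
  then show ?thesis
    using n j(1) by (auto simp: resolves_at_def)
qed

text \<open>Uniformity makes the families \<open>X i\<close> agree only on the index set
  \<open>J i\<close>, not as total functions, so passing from one to another needs a congruence
  rule.\<close>

lemma resolves_at_cong:
  assumes "J = J'" and "\<And>j. j \<in> J \<Longrightarrow> X j = X' j"
  shows "resolves_at I G J X = resolves_at I G J' X'"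
proof -
  have "constituent V X K G \<longleftrightarrow> constituent V X' K G" if "V \<subseteq> J" for V K
    unfolding constituent_def by (intro ball_cong refl) (use that assms(2) in auto)
  then show ?thesis
    unfolding resolves_at_def assms(1)[symmetric] by blast
qed

text \<open>Once \<open>k \<le> n\<close>, the indices of \<open>I\<close> from \<open>n\<close> on
  all lie in the tail, so both conditions quantify over the same \<open>t\<close>.\<close>

lemma ramsey_bound_index_ge:
  "ramsey_bound (index_ge I k) G S J X \<psi> n \<longleftrightarrow> ramsey_bound I G S J X \<psi> n \<and> k \<le> n"
  by (auto simp: ramsey_bound_def index_ge_def)

theorem theorem1:
  fixes I :: "'i::wellorder set"
    and G :: "'i \<Rightarrow> 'v ugraph"
    and A :: "'i \<Rightarrow> 'a set"
    and S :: "'i \<Rightarrow> ('v set \<Rightarrow> 'a) set"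
    and J :: "'i \<Rightarrow> 'j set"
    and X :: "'i \<Rightarrow> 'j \<Rightarrow> 'w ugraph"
    and \<psi> :: "'i \<Rightarrow> 'j \<Rightarrow> 'w set \<Rightarrow> 'a"
  assumes "ramsey_base I G A S"
    and "uniform_symbol I A J X \<psi>"
    and "admits_resolution I G (J (zero_index I)) (X (zero_index I))"
    (* an empty S i would satisfy the Ramsey condition vacuously, and the claim can then fail *)
    and "\<forall>i\<in>I. i < resolution_index I G (J (zero_index I)) (X (zero_index I)) \<longrightarrow> S i \<noteq> {}"
  shows "ramsey_number I G S J X \<psi> =
           ramsey_number (resolution_indices I G (J (zero_index I)) (X (zero_index I))) G S J X \<psi>"
proof -
  let ?o = "zero_index I"
  let ?k = "resolution_index I G (J ?o) (X ?o)"
  have her: "hereditary I G"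
    using assms(1) by (simp add: ramsey_base_def)
  have "?k \<le> n" if bound: "ramsey_bound I G S J X \<psi> n" for n
  proof (rule ccontr)
    assume "\<not> ?k \<le> n"
    moreover have n: "n \<in> I"
      using bound by (simp add: ramsey_bound_def)
    ultimately have "resolves_at I G (J n) (X n) n"
      using ramsey_bound_resolves_at[OF her bound] assms(4) by simp
    \<comment> \<open>The resolution was obtained for the \<open>n\<close>-th family, whereas
      \<open>?k\<close> is defined by the family at \<open>?o\<close>; uniformity, which compares an
      index with a later one, identifies the two.\<close>
    moreover have "?o \<in> I" "?o \<le> n"
      using n by (auto simp: zero_index_def intro: LeastI Least_le)
    then have "J ?o = J n" "\<And>j. j \<in> J ?o \<Longrightarrow> X ?o j = X n j"
      using assms(2) n unfolding uniform_symbol_def by blast+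
    then have "resolves_at I G (J ?o) (X ?o) = resolves_at I G (J n) (X n)"
      by (rule resolves_at_cong)
    ultimately have "?k \<le> n"
      unfolding resolution_index_def by (auto intro: Least_le)
    with \<open>\<not> ?k \<le> n\<close> show False ..
  qed
  \<comment> \<open>The bounds coincide as predicates, so existence and least element agree
    together; this covers the value \<open>None\<close> as well.\<close>
  then have "ramsey_bound (resolution_indices I G (J ?o) (X ?o)) G S J X \<psi> n
      \<longleftrightarrow> ramsey_bound I G S J X \<psi> n" for n
    by (auto simp: resolution_indices_def ramsey_bound_index_ge)
  then show ?thesis
    by (simp add: ramsey_number_def)
qed

end
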